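(* The algebra $S^{A_2}$ is generated by $S_1,T_1,U_1,S_2,T_2,U_2,H$, and it is presented, as a commutative $\mathbb{C}$-algebra on these generators, by the relations $$\begin{aligned} H^4&=-4S_1^2S_2^2-3T_1T_2H+5S_1S_2H^2-T_1S_2U_1-S_1T_2U_2,\\ HU_1&=-3S_1T_2-S_2U_2,\\ HU_2&=-3T_1S_2-S_1U_1,\\ U_1^2&=12S_1S_2^2-3S_2H^2+3T_2U_2,\\ U_2^2&=12S_1^2S_2-3S_1H^2+3T_1U_1,\\ U_1U_2&=9T_1T_2-12S_1S_2H+3H^3. \end{aligned}$$
   Context: Let $S=\mathbb{C}[a_1,a_2,b_1,b_2]$ be a polynomial algebra in four variables and put $a_3=-a_1-a_2$, $b_3=-b_1-b_2$. The group $A_2=S_3$ acts on $S$ by algebra automorphisms by simultaneously permuting the indices of $a_1,a_2,a_3$ and of $b_1,b_2,b_3$; $S^{A_2}$ is the algebra of invariants. Define the following elements of $S^{A_2}$: $S_1=-\frac{a_1a_2+a_2a_3+a_1a_3}{9}$, $T_1=-\frac{a_1a_2a_3}{9}$, $U_1=-\frac{a_1b_1^2+a_2b_2^2+a_3b_3^2}{9}$, $S_2=-\frac{b_1b_2+b_2b_3+b_1b_3}{9}$, $T_2=-\frac{b_1b_2b_3}{9}$, $U_2=-\frac{a_1^2b_1+a_2^2b_2+a_3^2b_3}{9}$, $H=-\frac{a_1b_1+a_2b_2+a_3b_3}{9}$. *)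

theory Defs
  imports Complex_Main "HOL-Library.Poly_Mapping" "HOL-Combinatorics.Permutations"
begin

text \<open>
  A polynomial over the complex numbers is a finitely supported map from monomials to
  coefficients, a monomial being a finitely supported map from variables to exponents.
  The ring operations are those of \<^theory>\<open>HOL-Library.Poly_Mapping\<close>.
\<close>

type_synonym 'v cpoly = "('v \<Rightarrow>\<^sub>0 nat) \<Rightarrow>\<^sub>0 complex"

definition Const :: "complex \<Rightarrow> 'v cpoly" where
  "Const c = Poly_Mapping.single 0 c"

definition Var :: "'v \<Rightarrow> 'v cpoly" where
  "Var v = Poly_Mapping.single (Poly_Mapping.single v 1) 1"

text \<open>The algebra homomorphism that sends every variable \<open>v\<close> to \<open>f v\<close>.\<close>

definition subst :: "('v \<Rightarrow> 'w cpoly) \<Rightarrow> 'v cpoly \<Rightarrow> 'w cpoly" where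
  "subst f p =
     (\<Sum>m\<in>Poly_Mapping.keys p. Const (Poly_Mapping.lookup p m) *
        (\<Prod>v\<in>Poly_Mapping.keys m. f v ^ Poly_Mapping.lookup m v))"

definition subalgebra :: "'v cpoly set \<Rightarrow> bool" where
  "subalgebra A \<longleftrightarrow>
     (\<forall>c. Const c \<in> A) \<and> (\<forall>p\<in>A. \<forall>q\<in>A. p + q \<in> A) \<and> (\<forall>p\<in>A. \<forall>q\<in>A. p * q \<in> A)"

text \<open>
  The subalgebra \<open>A\<close> is presented by the generators \<open>g v\<close> and the relators \<open>R\<close>: the
  homomorphism \<open>subst g\<close> from the polynomial algebra on the generators has image \<open>A\<close>, and its
  kernel is the ideal generated by \<open>R\<close>. This ideal is the span of \<open>R\<close> in the polynomial
  ring regarded as a module over itself.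
\<close>

definition presented_by :: "'w cpoly set \<Rightarrow> ('v \<Rightarrow> 'w cpoly) \<Rightarrow> 'v cpoly set \<Rightarrow> bool" where
  "presented_by A g R \<longleftrightarrow>
     range (subst g) = A \<and> {p. subst g p = 0} = module.span (*) R"

datatype svar = A1 | A2 | B1 | B2

text \<open>Only the values at the indices 1, 2, 3 of the following two families matter.\<close>

definition avar :: "nat \<Rightarrow> svar cpoly" where
  "avar i = (if i = 1 then Var A1 else if i = 2 then Var A2 else - Var A1 - Var A2)"

definition bvar :: "nat \<Rightarrow> svar cpoly" where
  "bvar i = (if i = 1 then Var B1 else if i = 2 then Var B2 else - Var B1 - Var B2)"

definition act :: "(nat \<Rightarrow> nat) \<Rightarrow> svar cpoly \<Rightarrow> svar cpoly" where
  "act \<sigma> = subst (\<lambda>v. case v of A1 \<Rightarrow> avar (\<sigma> 1) | A2 \<Rightarrow> avar (\<sigma> 2)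
                            | B1 \<Rightarrow> bvar (\<sigma> 1) | B2 \<Rightarrow> bvar (\<sigma> 2))"

definition invariants :: "svar cpoly set" where
  "invariants = {p. \<forall>\<sigma>. \<sigma> permutes {1, 2, 3} \<longrightarrow> act \<sigma> p = p}"

datatype gen = GS1 | GT1 | GU1 | GS2 | GT2 | GU2 | GH

fun generator :: "gen \<Rightarrow> svar cpoly" where
  "generator GS1 = Const (- 1 / 9) * (avar 1 * avar 2 + avar 2 * avar 3 + avar 1 * avar 3)"
| "generator GT1 = Const (- 1 / 9) * (avar 1 * avar 2 * avar 3)"
| "generator GU1 = Const (- 1 / 9) *
     (avar 1 * bvar 1 ^ 2 + avar 2 * bvar 2 ^ 2 + avar 3 * bvar 3 ^ 2)"
| "generator GS2 = Const (- 1 / 9) * (bvar 1 * bvar 2 + bvar 2 * bvar 3 + bvar 1 * bvar 3)"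
| "generator GT2 = Const (- 1 / 9) * (bvar 1 * bvar 2 * bvar 3)"
| "generator GU2 = Const (- 1 / 9) *
     (avar 1 ^ 2 * bvar 1 + avar 2 ^ 2 * bvar 2 + avar 3 ^ 2 * bvar 3)"
| "generator GH = Const (- 1 / 9) * (avar 1 * bvar 1 + avar 2 * bvar 2 + avar 3 * bvar 3)"

text \<open>The relation \<open>l = r\<close> is encoded by the relator \<open>l - r\<close>.\<close>

definition relators :: "gen cpoly set" where
  "relators =
     (let S1 = Var GS1; T1 = Var GT1; U1 = Var GU1;
          S2 = Var GS2; T2 = Var GT2; U2 = Var GU2; H = Var GH
      in { H^4 - (- 4 * S1^2 * S2^2 - 3 * T1 * T2 * H + 5 * S1 * S2 * H^2
                   - T1 * S2 * U1 - S1 * T2 * U2),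
           H * U1 - (- 3 * S1 * T2 - S2 * U2),
           H * U2 - (- 3 * T1 * S2 - S1 * U1),
           U1^2 - (12 * S1 * S2^2 - 3 * S2 * H^2 + 3 * T2 * U2),
           U2^2 - (12 * S1^2 * S2 - 3 * S1 * H^2 + 3 * T1 * U1),
           U1 * U2 - (9 * T1 * T2 - 12 * S1 * S2 * H + 3 * H^3) })"

end

theory Submission
  imports Defs "HOL-Computational_Algebra.Fundamental_Theorem_Algebra"
begin

text \<open>
  Generation: an invariant is the average of its translates, and averaging a monomial
  \<open>f(a\<^sub>1,b\<^sub>1) g(a\<^sub>2,b\<^sub>2)\<close> gives \<open>P(f) P(g) - P(f g)\<close>, where \<open>P\<close> denotes a polarized power sum. These
  lie in the algebra of the seven generators, since \<open>a\<^sub>i\<^sup>3 = 9 S\<^sub>1 a\<^sub>i - 9 T\<^sub>1\<close> reduces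
  the exponents below 3.

  Relations: modulo the relators every polynomial is a combination of \<open>1, H, H\<^sup>2, H\<^sup>3, U\<^sub>1, U\<^sub>2\<close>
  with coefficients in \<open>\<complex>[S\<^sub>1,T\<^sub>1,S\<^sub>2,T\<^sub>2]\<close>. Permuting the \<open>b\<^sub>i\<close> alone fixes the coefficients.
  The alternating sum of the six resulting equations isolates \<open>H\<^sup>3\<close>; afterwards the sum of two
  of them is a biquadratic polynomial in \<open>(a\<^sub>i, b\<^sub>j)\<close> that vanishes on a 3 by 3 grid. Hence the
  coefficients vanish wherever both discriminants are nonzero, and so identically.
  Polynomials are compared through their values at complex points.
\<close>

section \<open>Evaluation of polynomials at complex points\<close>

definition mon :: "('v \<Rightarrow> 'a::comm_semiring_1) \<Rightarrow> ('v \<Rightarrow>\<^sub>0 nat) \<Rightarrow> 'a" where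
  "mon x m = (\<Prod>v\<in>Poly_Mapping.keys m. x v ^ Poly_Mapping.lookup m v)"

definition ev :: "('v \<Rightarrow> complex) \<Rightarrow> 'v cpoly \<Rightarrow> complex" where
  "ev x p = (\<Sum>m\<in>Poly_Mapping.keys p. Poly_Mapping.lookup p m * mon x m)"

lemma mon_eq_prod_superset:
  assumes "finite V" "Poly_Mapping.keys m \<subseteq> V"
  shows "mon x m = (\<Prod>v\<in>V. x v ^ Poly_Mapping.lookup m v)"
  unfolding mon_def using assms
  by (intro prod.mono_neutral_left) (auto simp: in_keys_iff)

lemma mon_zero [simp]: "mon x 0 = 1"
  by (simp add: mon_def)

lemma mon_single [simp]: "mon x (Poly_Mapping.single v n) = x v ^ n"
  by (simp add: mon_def)

lemma mon_add: "mon x (m + n) = mon x m * mon x n"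
proof -
  let ?V = "Poly_Mapping.keys m \<union> Poly_Mapping.keys n"
  have "mon x (m + n) = (\<Prod>v\<in>?V. x v ^ Poly_Mapping.lookup (m + n) v)"
    by (rule mon_eq_prod_superset) (simp_all add: keys_add)
  moreover have "mon x m = (\<Prod>v\<in>?V. x v ^ Poly_Mapping.lookup m v)"
    by (intro mon_eq_prod_superset) auto
  moreover have "mon x n = (\<Prod>v\<in>?V. x v ^ Poly_Mapping.lookup n v)"
    by (intro mon_eq_prod_superset) auto
  ultimately show ?thesis
    by (simp add: lookup_add power_add prod.distrib)
qed

lemma mon_mult: "mon (\<lambda>v. x v * y v) m = mon x m * mon y m"
  by (simp add: mon_def power_mult_distrib prod.distrib)

lemma ev_eq_sum_superset:
  assumes "finite M" "Poly_Mapping.keys p \<subseteq> M"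
  shows "ev x p = (\<Sum>m\<in>M. Poly_Mapping.lookup p m * mon x m)"
  unfolding ev_def using assms
  by (intro sum.mono_neutral_left) (auto simp: in_keys_iff)

lemma ev_zero [simp]: "ev x 0 = 0"
  by (simp add: ev_def)

lemma ev_single [simp]: "ev x (Poly_Mapping.single m c) = c * mon x m"
  by (simp add: ev_def)

lemma ev_Const [simp]: "ev x (Const c) = c"
  by (simp add: Const_def)

lemma ev_Var [simp]: "ev x (Var v) = x v"
  by (simp add: Var_def)

lemma ev_one [simp]: "ev x 1 = 1"
  by (metis ev_single mon_zero mult_1 single_one)

lemma ev_add [simp]: "ev x (p + q) = ev x p + ev x q"
proof -
  let ?M = "Poly_Mapping.keys p \<union> Poly_Mapping.keys q"
  have "ev x (p + q) = (\<Sum>m\<in>?M. Poly_Mapping.lookup (p + q) m * mon x m)"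
    by (rule ev_eq_sum_superset) (simp_all add: keys_add)
  moreover have "ev x p = (\<Sum>m\<in>?M. Poly_Mapping.lookup p m * mon x m)"
    by (intro ev_eq_sum_superset) auto
  moreover have "ev x q = (\<Sum>m\<in>?M. Poly_Mapping.lookup q m * mon x m)"
    by (intro ev_eq_sum_superset) auto
  ultimately show ?thesis
    by (simp add: lookup_add sum.distrib ring_distribs)
qed

lemma poly_mapping_eq_sum_single:
  "(\<Sum>m\<in>Poly_Mapping.keys p. Poly_Mapping.single m (Poly_Mapping.lookup p m)) = p"
proof (rule poly_mapping_eqI)
  fix k
  have "(\<Sum>m\<in>Poly_Mapping.keys p. Poly_Mapping.lookup p m when m = k) = Poly_Mapping.lookup p k"
    by (cases "k \<in> Poly_Mapping.keys p")
      (auto simp: when_def sum.delta' in_keys_iff cong: if_cong)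
  then show "Poly_Mapping.lookup
      (\<Sum>m\<in>Poly_Mapping.keys p. Poly_Mapping.single m (Poly_Mapping.lookup p m)) k = Poly_Mapping.lookup p k"
    by (simp add: lookup_sum lookup_single)
qed

lemma poly_mapping_single_add_induct [case_names zero single add]:
  fixes p :: "'k \<Rightarrow>\<^sub>0 'a::comm_monoid_add"
  assumes "P 0" "\<And>m c. P (Poly_Mapping.single m c)" "\<And>p q. P p \<Longrightarrow> P q \<Longrightarrow> P (p + q)"
  shows "P p"
proof -
  have "P (\<Sum>m\<in>M. Poly_Mapping.single m (Poly_Mapping.lookup p m))" if "finite M" for M
    using that by induction (auto intro: assms)
  from this[of "Poly_Mapping.keys p"] show ?thesis
    by (simp add: poly_mapping_eq_sum_single)
qed

lemma ev_mult [simp]: "ev x (p * q) = ev x p * ev x q"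
proof (induction p rule: poly_mapping_single_add_induct)
  case (single m c)
  show ?case
    by (induction q rule: poly_mapping_single_add_induct)
      (simp_all add: mult_single mon_add ring_distribs)
qed (simp_all add: ring_distribs)

lemma ev_uminus [simp]: "ev x (- p) = - ev x p"
  by (metis add_eq_0_iff ev_add ev_zero right_minus)

lemma ev_diff [simp]: "ev x (p - q) = ev x p - ev x q"
  by (metis add_uminus_conv_diff ev_add ev_uminus)

lemma ev_power [simp]: "ev x (p ^ n) = ev x p ^ n"
  by (induction n) simp_all

lemma ev_sum [simp]: "ev x (sum f I) = (\<Sum>i\<in>I. ev x (f i))"
  by (induction I rule: infinite_finite_induct) simp_all

lemma ev_prod [simp]: "ev x (prod f I) = (\<Prod>i\<in>I. ev x (f i))"
  by (induction I rule: infinite_finite_induct) simp_all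

lemma ev_of_nat [simp]: "ev x (of_nat n) = of_nat n"
  by (induction n) simp_all

lemma ev_numeral [simp]: "ev x (numeral n) = numeral n"
  by (metis ev_of_nat of_nat_numeral)

lemma ev_subst [simp]: "ev x (subst f p) = ev (\<lambda>v. ev x (f v)) p"
proof -
  have "ev x (subst f p) = (\<Sum>m\<in>Poly_Mapping.keys p. Poly_Mapping.lookup p m *
      (\<Prod>v\<in>Poly_Mapping.keys m. ev x (f v) ^ Poly_Mapping.lookup m v))"
    by (simp add: subst_def)
  then show ?thesis by (simp only: ev_def[of _ p] mon_def)
qed

text \<open>Dedekind's argument: distinct monomials are distinct characters of the multiplicative
  monoid of points, hence linearly independent.\<close>

lemma sum_mon_eq_0_imp_coeff_eq_0:
  fixes c :: "('v \<Rightarrow>\<^sub>0 nat) \<Rightarrow> complex"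
  assumes "finite M" "\<And>x. (\<Sum>m\<in>M. c m * mon x m) = 0" "m \<in> M"
  shows "c m = 0"
  using assms
proof (induction M arbitrary: c m rule: finite_induct)
  case (insert n M)
  have "c k = 0" if k: "k \<in> M" for k
  proof -
    have "k \<noteq> n" using k insert.hyps by auto
    then obtain v where v: "Poly_Mapping.lookup k v \<noteq> Poly_Mapping.lookup n v"
      by (metis poly_mapping_eqI)
    \<comment> \<open>Doubling only the coordinate \<open>v\<close> multiplies the monomials
      \<open>k\<close> and \<open>n\<close> by different powers of 2, so the point \<open>y\<close>
      separates the two characters.\<close>
    define y :: "'v \<Rightarrow> complex" where "y = (\<lambda>w. if w = v then 2 else 1)"
    have y: "mon y m = 2 ^ Poly_Mapping.lookup m v" for m
    proof -
      let ?V = "insert v (Poly_Mapping.keys m)"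
      have "mon y m = (\<Prod>w\<in>?V. y w ^ Poly_Mapping.lookup m w)"
        by (rule mon_eq_prod_superset) auto
      also have "\<dots> = (\<Prod>w\<in>?V. if w = v then 2 ^ Poly_Mapping.lookup m w else 1)"
        by (rule prod.cong) (auto simp: y_def)
      finally show ?thesis by simp
    qed
    have "(\<Sum>m\<in>M. (c m * (mon y m - mon y n)) * mon x m) = 0" for x
    proof -
      \<comment> \<open>Subtracting \<open>mon y n\<close> times the relation at \<open>x\<close>
        from the relation at \<open>y * x\<close> cancels the term of \<open>n\<close> and leaves a
        shorter relation.\<close>
      have "(\<Sum>m\<in>M. (c m * (mon y m - mon y n)) * mon x m) =
          (\<Sum>m\<in>insert n M. c m * mon (\<lambda>v. y v * x v) m) - mon y n * (\<Sum>m\<in>insert n M. c m * mon x m)"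
        using insert.hyps
        by (simp add: mon_mult algebra_simps sum_distrib_left sum_subtractf sum.distrib)
      then show ?thesis using insert.prems(1) by simp
    qed
    then have "c k * (mon y k - mon y n) = 0" by (rule insert.IH[OF _ k])
    moreover have "mon y k \<noteq> mon y n"
      using v unfolding y by (metis norm_numeral norm_power power_inject_exp one_less_numeral_iff semiring_norm(76))
    ultimately show ?thesis by simp
  qed
  moreover from this have "c n * mon (\<lambda>_. 1) n = 0"
    using insert.prems(1)[of "\<lambda>_. 1"] insert.hyps by simp
  then have "c n = 0" by (simp add: mon_def)
  ultimately show ?case using insert.prems(2) by auto
qed simp

text \<open>The independence of monomials as functions lets polynomial identities be checked as
  identities between complex numbers.\<close>

lemma eq_0_if_ev_eq_0:
  assumes "\<And>x. ev x p = 0"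
  shows "p = 0"
proof (rule poly_mapping_eqI)
  fix m
  have "Poly_Mapping.lookup p m = 0" if "m \<in> Poly_Mapping.keys p"
    by (rule sum_mon_eq_0_imp_coeff_eq_0[OF finite_keys _ that]) (use assms in \<open>simp add: ev_def\<close>)
  then show "Poly_Mapping.lookup p m = Poly_Mapping.lookup 0 m"
    by (auto simp: in_keys_iff)
qed

lemma eq_if_ev_eq:
  assumes "\<And>x. ev x p = ev x q"
  shows "p = q"
  using eq_0_if_ev_eq_0[of "p - q"] assms by simp

text \<open>The monomials can be evaluated at \<open>l\<close> inside the ring of univariate
  polynomials. This gives access to the fact that such a polynomial with zero values is
  zero.\<close>

lemma ev_on_line: "\<exists>q. \<forall>z. ev (\<lambda>v. poly (l v) z) p = poly q z"
proof (intro exI allI)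
  show "ev (\<lambda>v. poly (l v) z) p = poly (\<Sum>m\<in>Poly_Mapping.keys p.
      smult (Poly_Mapping.lookup p m) (mon l m)) z" for z
    by (simp add: ev_def mon_def poly_sum poly_prod)
qed

section \<open>Subalgebras and images of substitutions\<close>

lemma subalgebra_prod:
  assumes "subalgebra A" "\<And>i. i \<in> I \<Longrightarrow> f i \<in> A"
  shows "prod f I \<in> A"
proof -
  have "1 \<in> A" using assms(1) unfolding subalgebra_def Const_def by (metis single_one)
  then show ?thesis using assms(2)
    by (induction I rule: infinite_finite_induct) (use assms(1) in \<open>auto simp: subalgebra_def\<close>)
qed

lemma subalgebra_power: "subalgebra A \<Longrightarrow> p \<in> A \<Longrightarrow> p ^ n \<in> A"
  using subalgebra_prod[of A "{..<n}" "\<lambda>_. p"] by simp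

lemma subalgebra_sum:
  assumes "subalgebra A" "\<And>i. i \<in> I \<Longrightarrow> f i \<in> A"
  shows "sum f I \<in> A"
proof -
  have "0 \<in> A" using assms(1) unfolding subalgebra_def Const_def by (metis single_zero)
  then show ?thesis using assms(2)
    by (induction I rule: infinite_finite_induct) (use assms(1) in \<open>auto simp: subalgebra_def\<close>)
qed

lemma subst_mem_subalgebra:
  assumes "subalgebra A" "\<And>v. f v \<in> A"
  shows "subst f p \<in> A"
  unfolding subst_def
  by (intro subalgebra_sum subalgebra_prod subalgebra_power assms)
    (use assms(1) in \<open>auto simp: subalgebra_def intro!: subalgebra_prod subalgebra_power assms\<close>)

lemma subst_Var: "subst f (Var v) = f v"
  by (rule eq_if_ev_eq) simp

lemma subst_Var_id: "subst Var p = p"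
  by (rule eq_if_ev_eq) simp

lemma subalgebra_range_subst: "subalgebra (range (subst f))"
  unfolding subalgebra_def
proof (intro conjI allI ballI)
  show "Const c \<in> range (subst f)" for c
    by (rule range_eqI[of _ _ "Const c"], rule eq_if_ev_eq) simp
next
  fix p q assume "p \<in> range (subst f)" "q \<in> range (subst f)"
  then obtain p' q' where "p = subst f p'" "q = subst f q'" by auto
  then have "p + q = subst f (p' + q')" "p * q = subst f (p' * q')"
    by (auto intro: eq_if_ev_eq)
  then show "p + q \<in> range (subst f)" "p * q \<in> range (subst f)" by auto
qed

lemma subalgebra_hull: "subalgebra (subalgebra hull X)"
  by (rule hull_in) (auto simp: subalgebra_def)

text \<open>This links the two halves of the theorem: generation by the seven elements is the same
  as surjectivity of the substitution onto the invariants.\<close>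

lemma range_subst_eq_hull: "range (subst f) = subalgebra hull (range f)"
proof (rule hull_unique[symmetric])
  show "range f \<subseteq> range (subst f)" by (metis subst_Var image_subsetI rangeI)
  show "range (subst f) \<subseteq> A" if "range f \<subseteq> A" "subalgebra A" for A
    using that by (auto intro!: subst_mem_subalgebra)
qed (rule subalgebra_range_subst)

lemma subalgebraD:
  assumes "subalgebra A"
  shows "Const c \<in> A" "p \<in> A \<Longrightarrow> q \<in> A \<Longrightarrow> p + q \<in> A" "p \<in> A \<Longrightarrow> q \<in> A \<Longrightarrow> p * q \<in> A"
  using assms by (auto simp: subalgebra_def)

lemma subalgebra_diff:
  assumes "subalgebra A" "p \<in> A" "q \<in> A"
  shows "p - q \<in> A"
proof -
  have "p - q = p + Const (- 1) * q" by (rule eq_if_ev_eq) simp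
  then show ?thesis using assms by (simp only:) (intro subalgebraD)
qed

section \<open>The action on indices and polarized power sums\<close>

text \<open>A permutation of three indices is determined by its values at 1 and 2. Indexing by this
  pair replaces sums over the group by sums over ordered pairs of distinct indices.\<close>

definition pullback :: "nat \<Rightarrow> nat \<Rightarrow> svar cpoly \<Rightarrow> svar cpoly" where
  "pullback i j = subst (\<lambda>v. case v of A1 \<Rightarrow> avar i | A2 \<Rightarrow> avar j | B1 \<Rightarrow> bvar i | B2 \<Rightarrow> bvar j)"

lemma act_eq_pullback: "act \<sigma> = pullback (\<sigma> 1) (\<sigma> 2)"
  by (simp only: act_def pullback_def)

lemma ev_pullback: "ev x (pullback i j p) =
   ev (\<lambda>v. case v of A1 \<Rightarrow> ev x (avar i) | A2 \<Rightarrow> ev x (avar j) | B1 \<Rightarrow> ev x (bvar i) | B2 \<Rightarrow> ev x (bvar j)) p"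
  unfolding pullback_def ev_subst by (rule arg_cong[where f = "\<lambda>y. ev y p"]) (auto split: svar.split)

lemma ex_permutes_123:
  assumes "i \<in> {1, 2, 3 :: nat}" "j \<in> {1, 2, 3}" "i \<noteq> j"
  shows "\<exists>\<sigma>. \<sigma> permutes {1, 2, 3} \<and> \<sigma> 1 = i \<and> \<sigma> 2 = j"
proof -
  \<comment> \<open>\<open>k\<close> is the preimage of \<open>j\<close> under the transposition of
    1 and \<open>i\<close>. Since \<open>k\<close> is not 1, swapping 2 with \<open>k\<close>
    beforehand leaves the image of 1 intact.\<close>
  define k where "k = transpose 1 i j"
  have k: "k \<in> {2, 3}" using assms by (auto simp: k_def transpose_def)
  let ?\<sigma> = "transpose 1 i \<circ> transpose 2 k"
  have "?\<sigma> permutes {1, 2, 3}"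
    using assms k by (intro permutes_compose permutes_swap_id) auto
  moreover have "?\<sigma> 1 = i" using k by (auto simp: transpose_def)
  moreover have "?\<sigma> 2 = j" by (simp add: k_def)
  ultimately show ?thesis by blast
qed

lemma avar_bvar_simps [simp]:
  "avar (Suc 0) = Var A1" "avar 2 = Var A2" "avar 3 = - Var A1 - Var A2"
  "bvar (Suc 0) = Var B1" "bvar 2 = Var B2" "bvar 3 = - Var B1 - Var B2"
  by (simp_all add: avar_def bvar_def)

definition psum :: "nat \<Rightarrow> nat \<Rightarrow> svar cpoly" where
  "psum m n = (\<Sum>i\<in>{1,2,3}. avar i ^ m * bvar i ^ n)"

text \<open>The values with both exponents below 3 start the recurrences; only
  \<open>psum 2 2\<close> needs products of generators. The two cubic values are included so that
  every generator is a multiple of a power sum.\<close>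

lemma psum_small:
  "psum 0 0 = Const 3" "psum 1 0 = Const 0" "psum 0 1 = Const 0"
  "psum 2 0 = Const 18 * generator GS1" "psum 0 2 = Const 18 * generator GS2"
  "psum 3 0 = Const (- 27) * generator GT1" "psum 0 3 = Const (- 27) * generator GT2"
  "psum 1 1 = Const (- 9) * generator GH" "psum 1 2 = Const (- 9) * generator GU1"
  "psum 2 1 = Const (- 9) * generator GU2"
  "psum 2 2 = Const 54 * (generator GS1 * generator GS2) + Const 27 * (generator GH * generator GH)"
  by (rule eq_if_ev_eq;
      simp add: psum_def avar_def bvar_def power2_eq_square power3_eq_cube algebra_simps)+

lemma act_psum:
  assumes \<sigma>: "\<sigma> permutes {1, 2, 3}"
  shows "act \<sigma> (psum m n) = psum m n"
proof (rule eq_if_ev_eq)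
  fix x
  define y where "y = (\<lambda>v. case v of A1 \<Rightarrow> ev x (avar (\<sigma> 1)) | A2 \<Rightarrow> ev x (avar (\<sigma> 2))
    | B1 \<Rightarrow> ev x (bvar (\<sigma> 1)) | B2 \<Rightarrow> ev x (bvar (\<sigma> 2)))"
  \<comment> \<open>The action prescribes the images of indices 1 and 2 only. That index 3 goes
    where the permutation sends it follows from the sums being zero.\<close>
  have "(\<Sum>i\<in>{1,2,3}. ev x (avar (\<sigma> i))) = 0" "(\<Sum>i\<in>{1,2,3}. ev x (bvar (\<sigma> i))) = 0"
    using sum.permute[OF \<sigma>, of "\<lambda>i. ev x (avar i)"] sum.permute[OF \<sigma>, of "\<lambda>i. ev x (bvar i)"]
    by (simp_all add: avar_def bvar_def)
  moreover have minus: "- a - b = c" if "a + (b + c) = 0" for a b c :: complex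
    using that by algebra
  ultimately have "ev y (avar i) = ev x (avar (\<sigma> i)) \<and> ev y (bvar i) = ev x (bvar (\<sigma> i))"
    if "i \<in> {1,2,3}" for i
    using that minus[of "ev x (avar (\<sigma> 1))"] minus[of "ev x (bvar (\<sigma> 1))"] by (auto simp: y_def)
  then have "ev y (psum m n) = (\<Sum>i\<in>{1,2,3}. ev x (avar (\<sigma> i)) ^ m * ev x (bvar (\<sigma> i)) ^ n)"
    unfolding psum_def ev_sum by (intro sum.cong) auto
  also have "\<dots> = ev x (psum m n)"
    using sum.permute[OF \<sigma>, of "\<lambda>i. ev x (avar i) ^ m * ev x (bvar i) ^ n"]
    by (simp only: psum_def ev_sum ev_mult ev_power o_def)
  finally show "ev x (act \<sigma> (psum m n)) = ev x (psum m n)"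
    unfolding act_eq_pullback ev_pullback y_def .
qed

text \<open>This reduces the invariance of the seven generators to that of power sums, where a
  permutation merely reorders the summands.\<close>

lemma generator_eq_psum: "\<exists>c m n. generator g = Const c * psum m n"
proof -
  have inv: "q = Const (1 / c) * p" if "p = Const c * q" "c \<noteq> 0" for p q :: "svar cpoly" and c
    by (rule eq_if_ev_eq) (use that in simp)
  show ?thesis
    by (cases g; hypsubst; intro exI; rule psum_small(4-10)[THEN inv]; simp)
qed

lemma subalgebra_invariants: "subalgebra invariants"
  unfolding subalgebra_def invariants_def
proof (intro conjI allI ballI CollectI impI)
  fix p q :: "svar cpoly" and \<sigma> and c
  show "act \<sigma> (Const c) = Const c"
    by (rule eq_if_ev_eq) (simp add: act_def)
  have "act \<sigma> (p + q) = act \<sigma> p + act \<sigma> q" "act \<sigma> (p * q) = act \<sigma> p * act \<sigma> q"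
    by (auto simp: act_def intro: eq_if_ev_eq)
  moreover assume "p \<in> {p. \<forall>\<sigma>. \<sigma> permutes {1, 2, 3} \<longrightarrow> act \<sigma> p = p}"
    "q \<in> {p. \<forall>\<sigma>. \<sigma> permutes {1, 2, 3} \<longrightarrow> act \<sigma> p = p}" "\<sigma> permutes {1, 2, 3}"
  ultimately show "act \<sigma> (p + q) = p + q" "act \<sigma> (p * q) = p * q"
    by auto
qed


lemma generator_invariant: "generator g \<in> invariants"
proof -
  obtain c m n where g: "generator g = Const c * psum m n"
    using generator_eq_psum by blast
  have "psum m n \<in> invariants" using act_psum by (simp add: invariants_def)
  then show ?thesis unfolding g by (intro subalgebraD subalgebra_invariants)
qed

lemma three_step_induct:
  assumes "P 0" "P 1" "P 2" "\<And>n. P n \<Longrightarrow> P (n + 1) \<Longrightarrow> P (n + 3)"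
  shows "P (n :: nat)"
proof -
  have "P n \<and> P (n + 1) \<and> P (n + 2)"
  proof (induction n)
    case 0 then show ?case using assms(1-3) by (simp add: numeral_2_eq_2)
  next
    case (Suc n) then show ?case using assms(4)[of n] by (simp add: numeral_eq_Suc)
  qed
  then show ?thesis by simp
qed

lemma power_recurrence:
  fixes t :: "'a::comm_ring_1"
  assumes "t ^ 3 = r * t - s"
  shows "t ^ (m + 3) = r * t ^ (m + 1) - s * t ^ m"
proof -
  have "t ^ (m + 3) = t ^ m * (r * t - s)" using assms by (simp add: power_add)
  then show ?thesis by (simp add: algebra_simps)
qed

text \<open>Each a_i is a root of X^3 - 9 S_1 X + 9 T_1, whose quadratic term is absent because the
  a_i sum to zero. The recurrence is this equation multiplied by a_i^m b_i^n and summed over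
  i.\<close>

lemma psum_rec_left:
  "psum (m + 3) n = Const 9 * generator GS1 * psum (m + 1) n - Const 9 * generator GT1 * psum m n"
proof -
  have "avar i ^ 3 = Const 9 * generator GS1 * avar i - Const 9 * generator GT1"
    if "i \<in> {1,2,3}" for i
    by (rule eq_if_ev_eq) (use that in \<open>auto simp: algebra_simps power3_eq_cube\<close>)
  note rec = this[THEN power_recurrence]
  show ?thesis
    unfolding psum_def sum_distrib_left sum_subtractf[symmetric]
    by (intro sum.cong refl) (simp only: rec left_diff_distrib mult.assoc)
qed

lemma psum_rec_right:
  "psum m (n + 3) = Const 9 * generator GS2 * psum m (n + 1) - Const 9 * generator GT2 * psum m n"
proof -
  have "bvar i ^ 3 = Const 9 * generator GS2 * bvar i - Const 9 * generator GT2"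
    if "i \<in> {1,2,3}" for i
    by (rule eq_if_ev_eq) (use that in \<open>auto simp: algebra_simps power3_eq_cube\<close>)
  note rec = this[THEN power_recurrence]
  show ?thesis
    unfolding psum_def sum_distrib_left sum_subtractf[symmetric]
    by (intro sum.cong refl) (simp only: rec right_diff_distrib mult.assoc mult.left_commute)
qed

lemma psum_mem:
  assumes A: "subalgebra A" "\<And>g. generator g \<in> A"
  shows "psum m n \<in> A"
\<comment> \<open>For \<open>m\<close> = 0, 1, 2 an inner induction treats every \<open>n\<close> by
  the recurrence in the b_i; the recurrence in the a_i then lowers larger \<open>m\<close>.\<close>
proof (induction m rule: three_step_induct)
  case 1 show ?case
    by (induction n rule: three_step_induct)
      (auto simp only: psum_small psum_rec_right intro!: subalgebraD subalgebra_diff A)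
next
  case 2 show ?case
    by (induction n rule: three_step_induct)
      (auto simp only: psum_small psum_rec_right intro!: subalgebraD subalgebra_diff A)
next
  case 3 show ?case
    by (induction n rule: three_step_induct)
      (auto simp only: psum_small psum_rec_right intro!: subalgebraD subalgebra_diff A)
next
  case (4 m) then show ?case
    by (auto simp only: psum_rec_left intro!: subalgebraD subalgebra_diff A)
qed

section \<open>Generation of the invariants by averaging\<close>

definition index_pairs :: "(nat \<times> nat) set" where
  "index_pairs = {(1,2),(1,3),(2,1),(2,3),(3,1),(3,2)}"

lemma pullback_single:
  "pullback i j (Poly_Mapping.single m c) = Const c *
     ((avar i ^ Poly_Mapping.lookup m A1 * bvar i ^ Poly_Mapping.lookup m B1) *
      (avar j ^ Poly_Mapping.lookup m A2 * bvar j ^ Poly_Mapping.lookup m B2))"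
proof (rule eq_if_ev_eq)
  fix x :: "svar \<Rightarrow> complex"
  have "mon y m = (\<Prod>v\<in>{A1,A2,B1,B2}. y v ^ Poly_Mapping.lookup m v)" for y :: "svar \<Rightarrow> complex"
    by (rule mon_eq_prod_superset) (use svar.exhaust in auto)
  then show "ev x (pullback i j (Poly_Mapping.single m c)) = ev x (Const c *
     ((avar i ^ Poly_Mapping.lookup m A1 * bvar i ^ Poly_Mapping.lookup m B1) *
      (avar j ^ Poly_Mapping.lookup m A2 * bvar j ^ Poly_Mapping.lookup m B2)))"
    by (simp add: ev_pullback)
qed

lemma sum_pullback_mem:
  assumes A: "subalgebra A" "\<And>g. generator g \<in> A"
  shows "(\<Sum>(i, j)\<in>index_pairs. pullback i j p) \<in> A"
proof (induction p rule: poly_mapping_single_add_induct)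
  case zero
  have "pullback i j 0 = 0" for i j by (simp add: pullback_def subst_def)
  then show ?case using subalgebra_sum[OF A(1), of "{}"] by simp
next
  case (add p q)
  have "pullback i j (p + q) = pullback i j p + pullback i j q" for i j
    by (rule eq_if_ev_eq) (simp add: ev_pullback)
  then show ?case using add subalgebraD[OF A(1)] by (simp add: sum.distrib case_prod_unfold)
next
  case (single m c)
  \<comment> \<open>The summand is a function of \<open>i\<close> times a function of
    \<open>j\<close>. The sum over distinct indices is the product of the two full sums minus the
    diagonal.\<close>
  have "(\<Sum>(i, j)\<in>index_pairs. pullback i j (Poly_Mapping.single m c)) = Const c *
      (psum (Poly_Mapping.lookup m A1) (Poly_Mapping.lookup m B1) *
       psum (Poly_Mapping.lookup m A2) (Poly_Mapping.lookup m B2) -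
       psum (Poly_Mapping.lookup m A1 + Poly_Mapping.lookup m A2)
         (Poly_Mapping.lookup m B1 + Poly_Mapping.lookup m B2))"
    by (simp add: index_pairs_def pullback_single psum_def power_add algebra_simps)
  then show ?case by (auto intro!: subalgebraD subalgebra_diff psum_mem A)
qed

lemma invariants_eq_hull: "subalgebra hull (range generator) = invariants"
proof (rule hull_unique)
  show "range generator \<subseteq> invariants" using generator_invariant by auto
next
  fix A assume A: "range generator \<subseteq> A" "subalgebra A"
  show "invariants \<subseteq> A"
  proof
    fix p assume p: "p \<in> invariants"
    have "pullback i j p = p" if "(i, j) \<in> index_pairs" for i j
    proof -
      have "i \<in> {1,2,3}" "j \<in> {1,2,3}" "i \<noteq> j" using that by (auto simp: index_pairs_def)
      then obtain \<sigma> where "\<sigma> permutes {1,2,3}" "\<sigma> 1 = i" "\<sigma> 2 = j"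
        using ex_permutes_123 by blast
      then show ?thesis using p by (auto simp: invariants_def act_eq_pullback)
    qed
    then have "(\<Sum>(i, j)\<in>index_pairs. pullback i j p) = (\<Sum>(i, j)\<in>index_pairs. p)"
      by (intro sum.cong) auto
    moreover have "card index_pairs = 6" by (simp add: index_pairs_def)
    ultimately have "p = Const (1 / 6) * (\<Sum>(i, j)\<in>index_pairs. pullback i j p)"
      by (auto intro!: eq_if_ev_eq)
    then show "p \<in> A"
      using A sum_pullback_mem[of A p] subalgebraD[of A] by (metis rangeI subsetD)
  qed
qed (rule subalgebra_invariants)

section \<open>The relators vanish on the generators\<close>

text \<open>Here the a_i and b_i stand for one third of the original linear forms. This turns the
  factors 1/9 into integers, and the relations become identities with integer coefficients.\<close>

lemma generator_relations:
  fixes a1 a2 a3 b1 b2 b3 s1 t1 u1 s2 t2 u2 h :: "'a::idom"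
  assumes "a3 = - a1 - a2" "b3 = - b1 - b2"
    and "s1 = - (a1 * a2 + a2 * a3 + a1 * a3)" "t1 = - 3 * (a1 * a2 * a3)"
    and "u1 = - 3 * (a1 * b1^2 + a2 * b2^2 + a3 * b3^2)"
    and "s2 = - (b1 * b2 + b2 * b3 + b1 * b3)" "t2 = - 3 * (b1 * b2 * b3)"
    and "u2 = - 3 * (a1^2 * b1 + a2^2 * b2 + a3^2 * b3)"
    and "h = - (a1 * b1 + a2 * b2 + a3 * b3)"
  shows "h^4 = - 4 * s1^2 * s2^2 - 3 * t1 * t2 * h + 5 * s1 * s2 * h^2 - t1 * s2 * u1 - s1 * t2 * u2"
    and "h * u1 = - 3 * s1 * t2 - s2 * u2"
    and "h * u2 = - 3 * t1 * s2 - s1 * u1"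
    and "u1^2 = 12 * s1 * s2^2 - 3 * s2 * h^2 + 3 * t2 * u2"
    and "u2^2 = 12 * s1^2 * s2 - 3 * s1 * h^2 + 3 * t1 * u1"
    and "u1 * u2 = 9 * t1 * t2 - 12 * s1 * s2 * h + 3 * h^3"
  unfolding assms by algebra+

lemma subst_relator_eq_0:
  assumes "r \<in> relators"
  shows "subst generator r = 0"
proof (rule eq_0_if_ev_eq_0)
  fix x :: "svar \<Rightarrow> complex"
  define a1 a2 b1 b2 where ab: "a1 = x A1 / 3" "a2 = x A2 / 3" "b1 = x B1 / 3" "b2 = x B2 / 3"
  have gen:
    "ev x (generator GS1) = - (a1 * a2 + a2 * (- a1 - a2) + a1 * (- a1 - a2))"
    "ev x (generator GT1) = - 3 * (a1 * a2 * (- a1 - a2))"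
    "ev x (generator GU1) = - 3 * (a1 * b1^2 + a2 * b2^2 + (- a1 - a2) * (- b1 - b2)^2)"
    "ev x (generator GS2) = - (b1 * b2 + b2 * (- b1 - b2) + b1 * (- b1 - b2))"
    "ev x (generator GT2) = - 3 * (b1 * b2 * (- b1 - b2))"
    "ev x (generator GU2) = - 3 * (a1^2 * b1 + a2^2 * b2 + (- a1 - a2)^2 * (- b1 - b2))"
    "ev x (generator GH) = - (a1 * b1 + a2 * b2 + (- a1 - a2) * (- b1 - b2))"
    by (simp_all add: ab power2_eq_square algebra_simps)
  note rel = generator_relations[OF refl refl gen]
  show "ev x (subst generator r) = 0"
    using assms
    by (auto simp only: relators_def Let_def insert_iff empty_iff ev_subst ev_diff ev_mult ev_power
        ev_Var ev_add ev_numeral ev_uminus right_minus_eq rel)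
qed

lemma module_mult: "module ((*) :: 'a::comm_ring_1 \<Rightarrow> 'a \<Rightarrow> 'a)"
  by unfold_locales (simp_all add: algebra_simps)

lemma span_relators_subset_kernel: "module.span (*) relators \<subseteq> {p. subst generator p = 0}"
proof -
  interpret ideal: module "(*) :: gen cpoly \<Rightarrow> gen cpoly \<Rightarrow> gen cpoly"
    by (rule module_mult)
  have "subst generator 0 = 0" "subst generator (p + q) = subst generator p + subst generator q"
    "subst generator (p * q) = subst generator p * subst generator q" for p q
    by (rule eq_if_ev_eq; simp del: generator.simps)+
  note hom = this
  show ?thesis
  proof (rule ideal.span_minimal)
    show "relators \<subseteq> {p. subst generator p = 0}" using subst_relator_eq_0 by blast
    show "ideal.subspace {p. subst generator p = 0}"
      by (rule ideal.subspaceI) (simp_all add: hom)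
  qed
qed

section \<open>Reduction to normal form modulo the relators\<close>

text \<open>S_1 and T_1 involve only the a_i, S_2 and T_2 only the b_i, and all four are symmetric.
  Hence permuting the b_i alone does not change the values of these coefficients.\<close>

definition base :: "gen cpoly set" where
  "base = subalgebra hull {Var GS1, Var GT1, Var GS2, Var GT2}"

lemma subalgebra_base: "subalgebra base"
  unfolding base_def by (rule subalgebra_hull)

text \<open>This serves twice: to fix the coefficients while the b_i are permuted alone, and to
  evaluate them at points where only the four base coordinates are matched.\<close>

lemma ev_base_cong:
  assumes c: "c \<in> base" and eq: "y GS1 = z GS1" "y GT1 = z GT1" "y GS2 = z GS2" "y GT2 = z GT2"
  shows "ev y c = ev z c"
proof -
  have "base \<subseteq> {c. ev y c = ev z c}"
    unfolding base_def by (rule hull_minimal) (auto simp: subalgebra_def eq)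
  with c show ?thesis by blast
qed

lemma base_intros:
  "Var GS1 \<in> base" "Var GT1 \<in> base" "Var GS2 \<in> base" "Var GT2 \<in> base"
  "Const c \<in> base" "0 \<in> base" "1 \<in> base" "numeral n \<in> base"
  "p \<in> base \<Longrightarrow> - p \<in> base" "p \<in> base \<Longrightarrow> p ^ k \<in> base"
  "p \<in> base \<Longrightarrow> q \<in> base \<Longrightarrow> p + q \<in> base"
  "p \<in> base \<Longrightarrow> q \<in> base \<Longrightarrow> p - q \<in> base"
  "p \<in> base \<Longrightarrow> q \<in> base \<Longrightarrow> p * q \<in> base"
proof -
  have "Var GS1 \<in> base \<and> Var GT1 \<in> base \<and> Var GS2 \<in> base \<and> Var GT2 \<in> base"
    unfolding base_def using hull_subset[of "{Var GS1, Var GT1, Var GS2, Var GT2}" subalgebra] by auto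
  then show "Var GS1 \<in> base" "Var GT1 \<in> base" "Var GS2 \<in> base" "Var GT2 \<in> base" by auto
  note sub = subalgebraD[OF subalgebra_base]
  show C: "Const c \<in> base" for c by (rule sub)
  show "p \<in> base \<Longrightarrow> p ^ k \<in> base" by (rule subalgebra_power[OF subalgebra_base])
  show "p \<in> base \<Longrightarrow> q \<in> base \<Longrightarrow> p + q \<in> base" by (rule sub)
  show "p \<in> base \<Longrightarrow> q \<in> base \<Longrightarrow> p * q \<in> base" by (rule sub)
  show diff: "p \<in> base \<Longrightarrow> q \<in> base \<Longrightarrow> p - q \<in> base" for p q
    by (rule subalgebra_diff[OF subalgebra_base])
  have "Const (numeral n) = (numeral n :: gen cpoly)" "Const 1 = (1 :: gen cpoly)"
    "Const 0 = (0 :: gen cpoly)"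
    by (rule eq_if_ev_eq; simp)+
  note const_eqs = this
  show "numeral n \<in> base" "1 \<in> base" "0 \<in> base"
    using C[of "numeral n"] C[of 1] C[of 0] by (simp_all only: const_eqs)
  show "p \<in> base \<Longrightarrow> - p \<in> base" using diff[OF \<open>0 \<in> base\<close>, of p] by simp
qed

text \<open>The sum of the ideal and the \<open>base\<close>-module spanned by six elements. The
  inductive form lets closure under multiplication be proved by rule induction.\<close>

inductive_set reducible :: "gen cpoly set" where
  basis: "b \<in> {1, Var GH, Var GH ^ 2, Var GH ^ 3, Var GU1, Var GU2} \<Longrightarrow> b \<in> reducible"
| ideal: "r \<in> module.span (*) relators \<Longrightarrow> r \<in> reducible"
| add: "p \<in> reducible \<Longrightarrow> q \<in> reducible \<Longrightarrow> p + q \<in> reducible"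
| scale: "c \<in> base \<Longrightarrow> p \<in> reducible \<Longrightarrow> c * p \<in> reducible"

definition normal_form :: "(nat \<Rightarrow> gen cpoly) \<Rightarrow> gen cpoly" where
  "normal_form c = c 0 + c 1 * Var GH + c 2 * Var GH ^ 2 + c 3 * Var GH ^ 3 + c 4 * Var GU1 + c 5 * Var GU2"

lemma reducible_normal_form:
  assumes "p \<in> reducible"
  obtains c r where "\<And>i. c i \<in> base" "r \<in> module.span (*) relators" "p = normal_form c + r"
proof -
  interpret ideal: module "(*) :: gen cpoly \<Rightarrow> gen cpoly \<Rightarrow> gen cpoly" by (rule module_mult)
  define N where "N = {normal_form c | c. range c \<subseteq> base}"
  have N: "normal_form c \<in> N" if "\<And>i. c i \<in> base" for c
    using that unfolding N_def by blast
  have NE: "\<exists>c. n = normal_form c \<and> range c \<subseteq> base" if "n \<in> N" for n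
    using that unfolding N_def by blast
  have N_add: "n + m \<in> N" if nm: "n \<in> N" "m \<in> N" for n m
  proof -
    obtain c where c: "n = normal_form c" "range c \<subseteq> base" using NE[OF nm(1)] by blast
    obtain d where d: "m = normal_form d" "range d \<subseteq> base" using NE[OF nm(2)] by blast
    have mem: "c i \<in> base" "d i \<in> base" for i by (rule subsetD[OF c(2)] subsetD[OF d(2)], rule rangeI)+
    have eq: "n + m = normal_form (\<lambda>i. c i + d i)"
      by (simp add: c(1) d(1) normal_form_def algebra_simps)
    show ?thesis unfolding eq by (intro N base_intros(11) mem)
  qed
  have N_scale: "e * n \<in> N" if e: "e \<in> base" and n: "n \<in> N" for e n
  proof -
    obtain c where c: "n = normal_form c" "range c \<subseteq> base" using NE[OF n] by blast
    have mem: "c i \<in> base" for i by (rule subsetD[OF c(2)], rule rangeI)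
    have eq: "e * n = normal_form (\<lambda>i. e * c i)"
      by (simp only: c(1) normal_form_def distrib_left mult.assoc)
    show ?thesis unfolding eq by (intro N base_intros(13) mem e)
  qed
  have "\<exists>n\<in>N. \<exists>r\<in>ideal.span relators. p = n + r"
    using assms
  proof induction
    case (basis b)
    \<comment> \<open>Unit vectors: \<open>normal_form (e k)\<close> is the basis element number
      \<open>k\<close>.\<close>
    define e :: "nat \<Rightarrow> nat \<Rightarrow> gen cpoly" where "e k i = (if i = k then 1 else 0)" for k i
    have e: "normal_form (e k) \<in> N" for k
      by (rule N) (simp add: e_def base_intros)
    have "1 = normal_form (e 0)" "Var GH = normal_form (e 1)" "Var GH ^ 2 = normal_form (e 2)"
      "Var GH ^ 3 = normal_form (e 3)" "Var GU1 = normal_form (e 4)" "Var GU2 = normal_form (e 5)"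
      by (simp_all add: normal_form_def e_def)
    with e have "1 \<in> N" "Var GH \<in> N" "Var GH ^ 2 \<in> N" "Var GH ^ 3 \<in> N" "Var GU1 \<in> N" "Var GU2 \<in> N"
      by metis+
    then have "b \<in> N" using basis by blast
    then show ?case using ideal.span_zero[of relators] by force
  next
    case (ideal r)
    have "0 = normal_form (\<lambda>_. 0)" by (simp add: normal_form_def)
    then have "0 \<in> N" using N[of "\<lambda>_. 0"] by (simp add: base_intros)
    then show ?case using ideal by force
  next
    case (add p q)
    then obtain n r m s where "n \<in> N" "r \<in> ideal.span relators" "p = n + r"
      "m \<in> N" "s \<in> ideal.span relators" "q = m + s"
      by blast
    then have "n + m \<in> N" "r + s \<in> ideal.span relators" "p + q = (n + m) + (r + s)"
      by (simp_all add: N_add ideal.span_add)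
    then show ?case by blast
  next
    case (scale e p)
    then obtain n r where "n \<in> N" "r \<in> ideal.span relators" "p = n + r"
      by blast
    then have "e * n \<in> N" "e * r \<in> ideal.span relators" "e * p = e * n + e * r"
      using N_scale scale.hyps(1) ideal.span_scale by (auto simp: distrib_left)
    then show ?case by blast
  qed
  then obtain n r where "n \<in> N" "r \<in> ideal.span relators" "p = n + r" by blast
  moreover from \<open>n \<in> N\<close> obtain c where "n = normal_form c" "range c \<subseteq> base" using NE by blast
  ultimately show thesis by (intro that[of c r]) auto
qed

lemma reducible_basis:
  "1 \<in> reducible" "Var GH \<in> reducible" "Var GH ^ 2 \<in> reducible" "Var GH ^ 3 \<in> reducible"
  "Var GU1 \<in> reducible" "Var GU2 \<in> reducible"
  by (rule reducible.basis; simp)+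

lemma reducible_base: "c \<in> base \<Longrightarrow> c \<in> reducible"
  using reducible.scale[OF _ reducible_basis(1)] by simp

lemma reducible_uminus: "p \<in> reducible \<Longrightarrow> - p \<in> reducible"
  using reducible.scale[OF base_intros(9)[OF base_intros(7)]] by simp

lemma reducible_diff: "p \<in> reducible \<Longrightarrow> q \<in> reducible \<Longrightarrow> p - q \<in> reducible"
  using reducible.add[OF _ reducible_uminus] by simp

lemma reducible_mod:
  assumes "p - q \<in> module.span (*) relators" "q \<in> reducible"
  shows "p \<in> reducible"
  using reducible.add[OF reducible.ideal[OF assms(1)] assms(2)] by simp

lemmas reducible_intros =
  reducible_basis reducible_base reducible.add reducible_diff reducible_uminus reducible.scale

text \<open>Multiplication by \<open>u\<close> is linear over \<open>base\<close> and preserves the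
  ideal, so testing it on the six basis elements suffices.\<close>

lemma reducible_mult_closed:
  assumes "u \<in> reducible" "u * Var GH \<in> reducible" "u * Var GH ^ 2 \<in> reducible"
    "u * Var GH ^ 3 \<in> reducible" "u * Var GU1 \<in> reducible" "u * Var GU2 \<in> reducible"
    and "p \<in> reducible"
  shows "u * p \<in> reducible"
  using assms(7)
proof induction
  case (basis b)
  then show ?case using assms(1-6) by auto
next
  case (ideal r)
  then show ?case by (intro reducible.ideal module.span_scale[OF module_mult])
next
  case (add p q)
  then show ?case by (simp add: distrib_left reducible.add)
next
  case (scale c p)
  then show ?case using reducible.scale by (metis mult.left_commute)
qed

text \<open>Each relator is one of these products minus a combination of basis elements over
  \<open>base\<close>, so it acts as a rewriting rule.\<close>

lemma reducible_products:
  "Var GH ^ 4 \<in> reducible" "Var GH * Var GU1 \<in> reducible" "Var GH * Var GU2 \<in> reducible"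
  "Var GU1 ^ 2 \<in> reducible" "Var GU2 ^ 2 \<in> reducible" "Var GU1 * Var GU2 \<in> reducible"
proof -
  have span: "r \<in> module.span (*) relators" if "r \<in> relators" for r
    by (rule module.span_base[OF module_mult that])
  show "Var GH ^ 4 \<in> reducible"
    by (rule reducible_mod, rule span, unfold relators_def Let_def,
        rule insertI1, intro reducible_intros base_intros)
  show "Var GH * Var GU1 \<in> reducible"
    by (rule reducible_mod, rule span, unfold relators_def Let_def,
        rule insertI2, rule insertI1, intro reducible_intros base_intros)
  show "Var GH * Var GU2 \<in> reducible"
    by (rule reducible_mod, rule span, unfold relators_def Let_def,
        rule insertI2, rule insertI2, rule insertI1, intro reducible_intros base_intros)
  show "Var GU1 ^ 2 \<in> reducible"
    by (rule reducible_mod, rule span, unfold relators_def Let_def,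
        rule insertI2, rule insertI2, rule insertI2, rule insertI1, intro reducible_intros base_intros)
  show "Var GU2 ^ 2 \<in> reducible"
    by (rule reducible_mod, rule span, unfold relators_def Let_def,
        rule insertI2, rule insertI2, rule insertI2, rule insertI2, rule insertI1, intro reducible_intros base_intros)
  show "Var GU1 * Var GU2 \<in> reducible"
    by (rule reducible_mod, rule span, unfold relators_def Let_def,
        rule insertI2, rule insertI2, rule insertI2, rule insertI2, rule insertI2, rule insertI1, intro reducible_intros base_intros)
qed

lemma reducible_mult_Var: "p \<in> reducible \<Longrightarrow> Var g * p \<in> reducible"
proof -
  note prods = reducible_products
  \<comment> \<open>Multiplication by H comes first, because the products of U_1 and U_2 with H^2
    and H^3 are then obtained by multiplying repeatedly by H.\<close>
  have H: "Var GH * p \<in> reducible" if "p \<in> reducible" for p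
  proof (rule reducible_mult_closed)
    have "Var GH * Var GH = Var GH ^ 2" "Var GH * Var GH ^ 2 = Var GH ^ 3"
      "Var GH * Var GH ^ 3 = Var GH ^ 4"
      by (simp_all add: eval_nat_numeral)
    then show "Var GH * Var GH \<in> reducible" "Var GH * Var GH ^ 2 \<in> reducible"
      "Var GH * Var GH ^ 3 \<in> reducible"
      by (simp_all only: prods reducible_basis)
  qed (rule that prods reducible_basis)+
  have "Var GU1 * Var GH \<in> reducible" "Var GU2 * Var GH \<in> reducible" "Var GU2 * Var GU1 \<in> reducible"
    using prods by (simp_all add: mult.commute)
  moreover have "Var u * Var GH ^ 2 \<in> reducible \<and> Var u * Var GH ^ 3 \<in> reducible"
    if "Var u * Var GH \<in> reducible" for u
  proof -
    have "Var GH * (Var u * Var GH) \<in> reducible" "Var GH * (Var GH * (Var u * Var GH)) \<in> reducible"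
      using H that by auto
    moreover have "Var GH * (Var u * Var GH) = Var u * Var GH ^ 2"
      "Var GH * (Var GH * (Var u * Var GH)) = Var u * Var GH ^ 3"
      by (simp_all only: power2_eq_square power3_eq_cube mult_ac)
    ultimately show ?thesis by (simp only:)
  qed
  moreover have "Var GU1 * Var GU1 \<in> reducible" "Var GU2 * Var GU2 \<in> reducible"
    using prods by (simp_all add: power2_eq_square)
  ultimately have "Var GU1 * p \<in> reducible" "Var GU2 * p \<in> reducible" if "p \<in> reducible" for p
    using that by (blast intro: reducible_mult_closed prods reducible_basis)+
  with H show "p \<in> reducible \<Longrightarrow> Var g * p \<in> reducible"
    by (cases g) (auto intro: reducible.scale base_intros)
qed

lemma all_reducible: "p \<in> reducible"
proof -
  \<comment> \<open>The multipliers preserving \<open>reducible\<close> form a subalgebra containing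
    every variable, hence everything. Applying a multiplier to 1 gives the claim.\<close>
  let ?A = "{p. \<forall>q\<in>reducible. p * q \<in> reducible}"
  have "subalgebra ?A"
    unfolding subalgebra_def
    by (auto simp: ring_distribs mult.assoc intro: reducible.add reducible.scale base_intros)
  then have "subst Var p \<in> ?A"
    by (rule subst_mem_subalgebra) (simp add: reducible_mult_Var)
  then have "p * 1 \<in> reducible"
    unfolding subst_Var_id using reducible_basis(1) by blast
  then show ?thesis by simp
qed

section \<open>Coefficients of a form vanishing under all permutations of the b_i\<close>

lemma quadratic_three_zeros:
  fixes x y z :: "'a::idom"
  assumes "x * t1^2 + y * t1 + z = 0" "x * t2^2 + y * t2 + z = 0" "x * t3^2 + y * t3 + z = 0"
    and "t1 \<noteq> t2" "t1 \<noteq> t3" "t2 \<noteq> t3"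
  shows "x = 0" "y = 0" "z = 0"
proof -
  have "(t1 - t2) * (x * (t1 + t2) + y) = 0" "(t1 - t3) * (x * (t1 + t3) + y) = 0"
    using assms(1-3) by algebra+
  then have *: "x * (t1 + t2) + y = 0" "x * (t1 + t3) + y = 0" using assms(4,5) by auto
  then have "x * (t2 - t3) = 0" by algebra
  then show x: "x = 0" using assms(6) by simp
  then show y: "y = 0" using * by simp
  show "z = 0" using assms(1) x y by simp
qed

text \<open>The value of a normal form at a point, with the powers of -1/9 from H, U_1 and U_2
  absorbed into the coefficients \<open>k\<close>.\<close>

definition cubic_form :: "(nat \<Rightarrow> 'a) \<Rightarrow> 'a \<Rightarrow> 'a \<Rightarrow> 'a \<Rightarrow> 'a \<Rightarrow> 'a \<Rightarrow> 'a \<Rightarrow> 'a::idom" where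
  "cubic_form k a1 a2 a3 b1 b2 b3 =
     (let h = a1 * b1 + a2 * b2 + a3 * b3 in
      k 0 + k 1 * h + k 2 * h^2 + k 3 * h^3 + k 4 * (a1 * b1^2 + a2 * b2^2 + a3 * b3^2)
        + k 5 * (a1^2 * b1 + a2^2 * b2 + a3^2 * b3))"

text \<open>The sum is alternating in the b_i, hence a multiple of their Vandermonde product, which
  has degree 3. Only the term \<open>h^3\<close> has degree 3 in the b_i, so it alone
  survives.\<close>

lemma cubic_form_alternating_sum:
  fixes a1 a2 a3 b1 b2 b3 :: "'a::idom"
  shows "cubic_form k a1 a2 a3 b1 b2 b3 - cubic_form k a1 a2 a3 b1 b3 b2
     - cubic_form k a1 a2 a3 b2 b1 b3 + cubic_form k a1 a2 a3 b2 b3 b1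
     + cubic_form k a1 a2 a3 b3 b1 b2 - cubic_form k a1 a2 a3 b3 b2 b1
     = 3 * k 3 * ((a1 - a2) * (a1 - a3) * (a2 - a3)) * ((b1 - b2) * (b1 - b3) * (b2 - b3))"
  unfolding cubic_form_def Let_def by algebra

text \<open>The sum is symmetric in \<open>b'\<close> and \<open>b''\<close>, and after a
  simultaneous renaming also in \<open>a'\<close> and \<open>a''\<close>. So it depends only on
  \<open>a\<close>, \<open>b\<close>, \<open>e\<close>, \<open>f\<close>, with degree at most 2 in
  \<open>a\<close> and in \<open>b\<close> once \<open>k 3\<close> is gone.\<close>

lemma cubic_form_pair_sum:
  fixes a a' a'' b b' b'' :: "'a::idom"
  assumes "k 3 = 0" "a'' = - a - a'" "b'' = - b - b'"
    and "e = a * a' + a * a'' + a' * a''" "f = b * b' + b * b'' + b' * b''"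
  shows "cubic_form k a a' a'' b b' b'' + cubic_form k a a' a'' b b'' b'
     = (9 * k 2 * a^2 + 3 * k 4 * a + 6 * e * k 2) * b^2
       + (3 * k 5 * a^2 + 3 * k 1 * a + 2 * e * k 5) * b
       + (2 * k 0 + 6 * f * k 2 * a^2 + 8 * e * f * k 2 + 2 * f * k 4 * a)"
  unfolding cubic_form_def Let_def assms by algebra

text \<open>Simultaneous renaming changes nothing, so moving another a_i to the front amounts to
  rearranging the b_i. The six given equations therefore cover every choice of the first
  a_i.\<close>

lemma cubic_form_permute:
  fixes a1 a2 a3 b1 b2 b3 :: "'a::idom"
  shows "cubic_form k a2 a1 a3 b1 b2 b3 = cubic_form k a1 a2 a3 b2 b1 b3"
    and "cubic_form k a3 a1 a2 b1 b2 b3 = cubic_form k a1 a2 a3 b2 b3 b1"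
  unfolding cubic_form_def Let_def by algebra+

lemma cubic_form_orbit_eq_0:
  fixes a1 a2 a3 b1 b2 b3 :: "'a::{idom, ring_char_0}"
  assumes a: "a1 \<noteq> a2" "a1 \<noteq> a3" "a2 \<noteq> a3" "a1 + a2 + a3 = 0"
    and b: "b1 \<noteq> b2" "b1 \<noteq> b3" "b2 \<noteq> b3" "b1 + b2 + b3 = 0"
    and Z: "cubic_form k a1 a2 a3 b1 b2 b3 = 0" "cubic_form k a1 a2 a3 b1 b3 b2 = 0"
      "cubic_form k a1 a2 a3 b2 b1 b3 = 0" "cubic_form k a1 a2 a3 b2 b3 b1 = 0"
      "cubic_form k a1 a2 a3 b3 b1 b2 = 0" "cubic_form k a1 a2 a3 b3 b2 b1 = 0"
    and "i \<le> 5"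
  shows "k i = 0"
proof -
  have "3 * k 3 * ((a1 - a2) * (a1 - a3) * (a2 - a3)) * ((b1 - b2) * (b1 - b3) * (b2 - b3)) = 0"
    using cubic_form_alternating_sum[of k a1 a2 a3 b1 b2 b3] unfolding Z by simp
  then have k3: "k 3 = 0" using a b by simp
  define e f where "e = a1 * a2 + a1 * a3 + a2 * a3" and "f = b1 * b2 + b1 * b3 + b2 * b3"
  define A B C where "A = (\<lambda>a. 9 * k 2 * a^2 + 3 * k 4 * a + 6 * e * k 2)"
    and "B = (\<lambda>a. 3 * k 5 * a^2 + 3 * k 1 * a + 2 * e * k 5)"
    and "C = (\<lambda>a. 2 * k 0 + 6 * f * k 2 * a^2 + 8 * e * f * k 2 + 2 * f * k 4 * a)"
  \<comment> \<open>Exactly two permutations match a given \<open>a\<close> with a given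
    \<open>b\<close>; adding their equations gives one equation per point of the 3 by 3
    grid.\<close>
  have G: "A a * b^2 + B a * b + C a = 0"
    if "a'' = - a - a'" "b'' = - b - b'" "e = a * a' + a * a'' + a' * a''" "f = b * b' + b * b'' + b' * b''"
      "cubic_form k a a' a'' b b' b'' = 0" "cubic_form k a a' a'' b b'' b' = 0" for a a' a'' b b' b''
    using cubic_form_pair_sum[of k, OF k3 that(1-4)] unfolding that(5,6) A_def B_def C_def by simp
  have a_sum: "a3 = - a1 - a2" "a3 = - a2 - a1" "a2 = - a3 - a1"
    and b_sum: "b3 = - b1 - b2" "b3 = - b2 - b1" "b2 = - b3 - b1"
    using a(4) b(4) by algebra+
  have e: "e = a1 * a2 + a1 * a3 + a2 * a3" "e = a2 * a1 + a2 * a3 + a1 * a3"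
      "e = a3 * a1 + a3 * a2 + a1 * a2"
    and f: "f = b1 * b2 + b1 * b3 + b2 * b3" "f = b2 * b1 + b2 * b3 + b1 * b3"
      "f = b3 * b1 + b3 * b2 + b1 * b2"
    unfolding e_def f_def by algebra+
  have AB: "A a = 0 \<and> B a = 0" if "a \<in> {a1, a2, a3}" for a
  proof -
    have "A a * b1^2 + B a * b1 + C a = 0 \<and> A a * b2^2 + B a * b2 + C a = 0 \<and> A a * b3^2 + B a * b3 + C a = 0"
      using that
    proof (elim insertE emptyE)
      assume "a = a1"
      then show ?thesis
        using G[OF a_sum(1) b_sum(1) e(1) f(1)] G[OF a_sum(1) b_sum(2) e(1) f(2)]
          G[OF a_sum(1) b_sum(3) e(1) f(3)] by (simp only: Z)
    next
      assume "a = a2"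
      then show ?thesis
        using G[OF a_sum(2) b_sum(1) e(2) f(1)] G[OF a_sum(2) b_sum(2) e(2) f(2)]
          G[OF a_sum(2) b_sum(3) e(2) f(3)] by (simp only: Z cubic_form_permute(1)[of k a2 a1 a3])
    next
      assume "a = a3"
      then show ?thesis
        using G[OF a_sum(3) b_sum(1) e(3) f(1)] G[OF a_sum(3) b_sum(2) e(3) f(2)]
          G[OF a_sum(3) b_sum(3) e(3) f(3)] by (simp only: Z cubic_form_permute(2)[of k a3 a1 a2])
    qed
    then show ?thesis using quadratic_three_zeros[of "A a" b1 "B a" "C a" b2 b3] b by blast
  qed
  \<comment> \<open>For each a_i the quadratic in b has three distinct zeros. The resulting zeros of
    \<open>A\<close> and \<open>B\<close> are in turn three distinct zeros of quadratics in
    a.\<close>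
  have "9 * k 2 = 0 \<and> 3 * k 4 = 0"
    using AB quadratic_three_zeros[of "9 * k 2" a1 "3 * k 4" "6 * e * k 2" a2 a3] a
    unfolding A_def by blast
  moreover have "3 * k 5 = 0 \<and> 3 * k 1 = 0"
    using AB quadratic_three_zeros[of "3 * k 5" a1 "3 * k 1" "2 * e * k 5" a2 a3] a
    unfolding B_def by blast
  ultimately have k: "k 1 = 0" "k 2 = 0" "k 4 = 0" "k 5 = 0" by simp_all
  \<comment> \<open>With the other five coefficients gone, any one of the original equations reads
    \<open>k 0 = 0\<close>.\<close>
  then have "k 0 = 0" using Z(1) k3 by (simp add: cubic_form_def)
  moreover have "i = 0 \<or> i = 1 \<or> i = 2 \<or> i = 3 \<or> i = 4 \<or> i = 5" using \<open>i \<le> 5\<close> by linarith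
  ultimately show ?thesis using k k3 by metis
qed

section \<open>Vanishing of the normal form coefficients\<close>

text \<open>X^3 + s X - t splits over the complex numbers and its roots sum to zero;
  \<open>a1\<close> and \<open>a2\<close> are two of them.\<close>

lemma cubic_symmetric_functions_surj:
  fixes s t :: complex
  shows "\<exists>a1 a2. a1 * a2 + a2 * (- a1 - a2) + a1 * (- a1 - a2) = s \<and> a1 * a2 * (- a1 - a2) = t"
proof -
  have "\<not> constant (poly [:- t, s, 0, 1:])" by (simp add: constant_degree)
  then obtain a1 where a1: "poly [:- t, s, 0, 1:] a1 = 0"
    using fundamental_theorem_of_algebra by blast
  \<comment> \<open>This quadratic is the quotient of the cubic by X - \<open>a1\<close>.\<close>
  have "\<not> constant (poly [:a1^2 + s, a1, 1:])" by (simp add: constant_degree)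
  then obtain a2 where a2: "poly [:a1^2 + s, a1, 1:] a2 = 0"
    using fundamental_theorem_of_algebra by blast
  have "a1^3 + s * a1 - t = 0" "a2^2 + a1 * a2 + a1^2 + s = 0"
    using a1 a2 by (simp_all add: algebra_simps power2_eq_square power3_eq_cube)
  then have "a1 * a2 + a2 * (- a1 - a2) + a1 * (- a1 - a2) = s" "a1 * a2 * (- a1 - a2) = t"
    by algebra+
  then show ?thesis by blast
qed

text \<open>The cubic can be solved for the a_i and the b_i separately. As all values occur, a
  coefficient in \<open>base\<close> is zero as soon as its image under the substitution is.\<close>

lemma ev_generator_base_surj:
  fixes y :: "gen \<Rightarrow> complex"
  obtains x where "ev x (generator GS1) = y GS1" "ev x (generator GT1) = y GT1"
    "ev x (generator GS2) = y GS2" "ev x (generator GT2) = y GT2"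
proof -
  obtain a1 a2 where a: "a1 * a2 + a2 * (- a1 - a2) + a1 * (- a1 - a2) = - 9 * y GS1"
    "a1 * a2 * (- a1 - a2) = - 9 * y GT1"
    using cubic_symmetric_functions_surj by blast
  obtain b1 b2 where b: "b1 * b2 + b2 * (- b1 - b2) + b1 * (- b1 - b2) = - 9 * y GS2"
    "b1 * b2 * (- b1 - b2) = - 9 * y GT2"
    using cubic_symmetric_functions_surj by blast
  define x where "x = (\<lambda>v. case v of A1 \<Rightarrow> a1 | A2 \<Rightarrow> a2 | B1 \<Rightarrow> b1 | B2 \<Rightarrow> b2)"
  have x: "x A1 = a1" "x A2 = a2" "x B1 = b1" "x B2 = b2" by (simp_all add: x_def)
  have "ev x (generator GS1) = - 1 / 9 * (- 9 * y GS1)" "ev x (generator GT1) = - 1 / 9 * (- 9 * y GT1)"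
    "ev x (generator GS2) = - 1 / 9 * (- 9 * y GS2)" "ev x (generator GT2) = - 1 / 9 * (- 9 * y GT2)"
    unfolding a[symmetric] b[symmetric] by (simp_all add: x)
  then show thesis by (intro that) simp_all
qed

text \<open>On the line through a given point in the direction \<open>(1, 3, 1, 3)\<close> the discriminants vanish at
  finitely many points only.\<close>

lemma eq_0_if_eq_0_off_discriminant:
  fixes p :: "svar cpoly"
  assumes "\<And>x. x A1 \<noteq> x A2 \<Longrightarrow> x A1 \<noteq> - x A1 - x A2 \<Longrightarrow> x A2 \<noteq> - x A1 - x A2 \<Longrightarrow>
      x B1 \<noteq> x B2 \<Longrightarrow> x B1 \<noteq> - x B1 - x B2 \<Longrightarrow> x B2 \<noteq> - x B1 - x B2 \<Longrightarrow> ev x p = 0"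
  shows "p = 0"
proof (rule eq_0_if_ev_eq_0)
  fix x :: "svar \<Rightarrow> complex"
  define l where "l = (\<lambda>v. case v of A1 \<Rightarrow> [:x A1, 1:] | A2 \<Rightarrow> [:x A2, 3:]
    | B1 \<Rightarrow> [:x B1, 1:] | B2 \<Rightarrow> [:x B2, 3:])"
  obtain q where q: "\<forall>z. ev (\<lambda>v. poly (l v) z) p = poly q z"
    using ev_on_line by blast
  define D where "D = (l A1 - l A2) * (l A1 - (- l A1 - l A2)) * (l A2 - (- l A1 - l A2)) *
    ((l B1 - l B2) * (l B1 - (- l B1 - l B2)) * (l B2 - (- l B1 - l B2)))"
  \<comment> \<open>The six factors have slopes -2, 5, 7 and again -2, 5, 7, so none of them is
    zero.\<close>
  have "D \<noteq> 0" by (simp add: D_def l_def)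
  have "poly (q * D) z = 0" for z
  proof (cases "poly D z = 0")
    case False
    then have "poly q z = 0"
      unfolding q[rule_format, symmetric] by (intro assms) (auto simp: D_def)
    then show ?thesis by simp
  qed simp
  then have "q * D = 0" using poly_all_0_iff_0 by blast
  with \<open>D \<noteq> 0\<close> have "q = 0" by simp
  then have "ev (\<lambda>v. poly (l v) 0) p = 0" by (simp add: q)
  moreover have "(\<lambda>v. poly (l v) 0) = x" by (auto simp: l_def split: svar.split)
  ultimately show "ev x p = 0" by simp
qed

lemma normal_form_coeff_eq_0:
  assumes c: "\<And>i. c i \<in> base" and 0: "subst generator (normal_form c) = 0" and "i \<le> 5"
  shows "c i = 0"
proof -
  have "subst generator (c i) = 0"
  proof (rule eq_0_if_eq_0_off_discriminant)
    fix x :: "svar \<Rightarrow> complex"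
    define a1 a2 a3 b1 b2 b3 where ab: "a1 = x A1" "a2 = x A2" "a3 = - a1 - a2"
      "b1 = x B1" "b2 = x B2" "b3 = - b1 - b2"
    assume neq: "x A1 \<noteq> x A2" "x A1 \<noteq> - x A1 - x A2" "x A2 \<noteq> - x A1 - x A2"
      "x B1 \<noteq> x B2" "x B1 \<noteq> - x B1 - x B2" "x B2 \<noteq> - x B1 - x B2"
    define d where "d i = ev x (subst generator (c i))" for i
    \<comment> \<open>The list holds the powers of -1/9 up to the third, for 1, H, H^2, H^3,
      followed by -1/9 for U_1 and for U_2.\<close>
    define k where "k i = [1, - 1 / 9, 1 / 81, - 1 / 729, - 1 / 9, - 1 / 9] ! i * d i" for i
    \<comment> \<open>The triple \<open>p1\<close>, \<open>p2\<close>, \<open>p3\<close> stands for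
      a rearrangement of the b_i; equality of the symmetric functions is what keeps the coefficients
      \<open>d i\<close> unchanged.\<close>
    have form: "cubic_form k a1 a2 a3 p1 p2 p3 = 0"
      if p: "p3 = - p1 - p2" "p1 * p2 + p2 * p3 + p1 * p3 = b1 * b2 + b2 * b3 + b1 * b3"
        "p1 * p2 * p3 = b1 * b2 * b3" for p1 p2 p3
    proof -
      define y where "y = (\<lambda>v. case v of A1 \<Rightarrow> a1 | A2 \<Rightarrow> a2 | B1 \<Rightarrow> p1 | B2 \<Rightarrow> p2)"
      have d: "ev y (subst generator (c i)) = d i" for i
        unfolding d_def ev_subst
        by (rule ev_base_cong[OF c])
          (use p(2,3) in \<open>simp_all add: y_def ab[symmetric] p(1)[symmetric] ab(3)[symmetric]\<close>)
      have gen: "ev y (generator GH) = - 1 / 9 * (a1 * p1 + a2 * p2 + a3 * p3)"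
        "ev y (generator GU1) = - 1 / 9 * (a1 * p1^2 + a2 * p2^2 + a3 * p3^2)"
        "ev y (generator GU2) = - 1 / 9 * (a1^2 * p1 + a2^2 * p2 + a3^2 * p3)"
        by (simp_all add: y_def p(1) ab(3))
      have "0 = ev y (subst generator (normal_form c))" using 0 by simp
      also have "\<dots> = ev y (subst generator (c 0)) + ev y (subst generator (c 1)) * ev y (generator GH)
          + ev y (subst generator (c 2)) * ev y (generator GH) ^ 2
          + ev y (subst generator (c 3)) * ev y (generator GH) ^ 3
          + ev y (subst generator (c 4)) * ev y (generator GU1)
          + ev y (subst generator (c 5)) * ev y (generator GU2)"
        by (simp only: normal_form_def ev_subst ev_add ev_mult ev_power ev_Var)
      also have "\<dots> = cubic_form k a1 a2 a3 p1 p2 p3"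
        unfolding d gen cubic_form_def Let_def k_def
        by (simp add: power_mult_distrib power_divide mult_ac)
      finally show ?thesis by simp
    qed
    have "k i = 0"
    proof (rule cubic_form_orbit_eq_0)
      show "a1 \<noteq> a2" "a1 \<noteq> a3" "a2 \<noteq> a3" "b1 \<noteq> b2" "b1 \<noteq> b3" "b2 \<noteq> b3"
        using neq by (simp_all add: ab)
      show "a1 + a2 + a3 = 0" "b1 + b2 + b3 = 0" by (simp_all add: ab(3,6))
      show "cubic_form k a1 a2 a3 b1 b2 b3 = 0" "cubic_form k a1 a2 a3 b1 b3 b2 = 0"
        "cubic_form k a1 a2 a3 b2 b1 b3 = 0" "cubic_form k a1 a2 a3 b2 b3 b1 = 0"
        "cubic_form k a1 a2 a3 b3 b1 b2 = 0" "cubic_form k a1 a2 a3 b3 b2 b1 = 0"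
        by (rule form; simp add: ab(6); algebra)+
    qed fact
    moreover have "i \<in> {0, 1, 2, 3, 4, 5}" using \<open>i \<le> 5\<close> by auto
    ultimately have "d i = 0" by (auto simp: k_def)
    then show "ev x (subst generator (c i)) = 0" by (simp add: d_def)
  qed
  show ?thesis
  proof (rule eq_0_if_ev_eq_0)
    fix y
    \<comment> \<open>The point \<open>x\<close> need not reproduce \<open>y\<close> at H, U_1 and
      U_2, since \<open>c i\<close> sees only the four base coordinates.\<close>
    obtain x where "ev x (generator GS1) = y GS1" "ev x (generator GT1) = y GT1"
      "ev x (generator GS2) = y GS2" "ev x (generator GT2) = y GT2"
      by (rule ev_generator_base_surj)
    then have "ev y (c i) = ev x (subst generator (c i))"
      unfolding ev_subst by (intro ev_base_cong c) simp_all
    also have "\<dots> = 0" using \<open>subst generator (c i) = 0\<close> by simp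
    finally show "ev y (c i) = 0" .
  qed
qed

section \<open>The kernel and the presentation\<close>

lemma kernel_eq_span_relators: "{p. subst generator p = 0} = module.span (*) relators"
proof
  show "{p. subst generator p = 0} \<subseteq> module.span (*) relators"
  proof
    fix p assume "p \<in> {p. subst generator p = 0}"
    then have p: "subst generator p = 0" by simp
    \<comment> \<open>Any kernel element is a normal form plus an element of the ideal. The normal
      form then lies in the kernel too, so its coefficients vanish and only the ideal part
      remains.\<close>
    obtain c r where c: "\<And>i. c i \<in> base" and r: "r \<in> module.span (*) relators"
      and p_eq: "p = normal_form c + r"
      using reducible_normal_form[OF all_reducible] by blast
    have "subst generator r = 0" using r span_relators_subset_kernel by blast
    moreover have "subst generator p = subst generator (normal_form c) + subst generator r"
      unfolding p_eq by (rule eq_if_ev_eq) (simp only: ev_subst ev_add)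
    ultimately have "subst generator (normal_form c) = 0" using p by simp
    then have "c i = 0" if "i \<le> 5" for i
      using normal_form_coeff_eq_0 c that by blast
    then have "normal_form c = 0" by (simp add: normal_form_def)
    with p_eq r show "p \<in> module.span (*) relators" by simp
  qed
qed (rule span_relators_subset_kernel)

theorem mainTheorem3:
  shows "subalgebra hull (range generator) = invariants
       \<and> presented_by invariants generator relators"
  unfolding presented_by_def
  using invariants_eq_hull range_subst_eq_hull kernel_eq_span_relators by metis

end
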